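(* For every $k\ge1$ there exists a $\delta$-tester for $k$-wise uniformity of distributions on $\{-1,1\}^n$ with sample complexity $O(1/k)^{k/2}\cdot\frac{n^k}{\delta^2}$ (i.e. at most $(C/k)^{k/2} n^k/\delta^2$ for a universal constant $C$). For the special case $k=1$, there is a $\delta$-tester with sample complexity $O\!\left(\frac{\log n}{\delta^2}\right)$.
   Context: Distributions on $\{-1,1\}^n$ are identified with densities $\varphi:\{-1,1\}^n\to\mathbb{R}^{\ge0}$ with $\mathbb{E}_{x\sim\{-1,1\}^n}[\varphi(x)]=1$, $\Pr[x]=\varphi(x)/2^n$; $\widehat\varphi(S)=\mathbb{E}_{x\sim\{-1,1\}^n}[\varphi(x)\prod_{i\in S}x_i]$. $\varphi$ is $k$-wise uniform iff $\widehat\varphi(S)=0$ for all $1\le|S|\le k$. $\varphi$ is $\delta$-far from $k$-wise uniform if its total variation distance $\frac12\mathbb{E}_x|\varphi(x)-\psi(x)|$ to every $k$-wise uniform density $\psi$ exceeds $\delta$. A $\delta$-tester for $k$-wise uniformity is an algorithm that receives i.i.d. samples from an unknown distribution $\varphi$ and outputs "Yes" with high probability (at least $2/3$) if $\varphi$ is $k$-wise uniform and "No" with high probability if $\varphi$ is $\delta$-far from $k$-wise uniform; its sample complexity is the number of samples used.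
   Formalization: The first bound is stated for 1 ≤ k ≤ n and the log n bound for n ≥ 2; for n = 1 with k large, or with log n = 0, the stated bounds would allow zero samples, which cannot suffice for δ < 1/2. *)

theory Defs
  imports "HOL-Probability.Probability"
begin

text \<open>
  The dimension \<open>n\<close> is a number, not a type, because the constants in the bounds must not
  depend on it.  A point of \<open>{-1,1}\<^sup>n\<close> is a function on \<open>{..<n}\<close>, extended by \<open>undefined\<close>.
\<close>

definition hypercube :: "nat \<Rightarrow> (nat \<Rightarrow> real) set" where
  "hypercube n = {..<n} \<rightarrow>\<^sub>E {-1, 1}"

definition cube_expectation :: "nat \<Rightarrow> ((nat \<Rightarrow> real) \<Rightarrow> real) \<Rightarrow> real" where
  "cube_expectation n f = measure_pmf.expectation (pmf_of_set (hypercube n)) f"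

definition cube_density :: "nat \<Rightarrow> ((nat \<Rightarrow> real) \<Rightarrow> real) \<Rightarrow> bool" where
  "cube_density n \<phi> \<longleftrightarrow> (\<forall>x\<in>hypercube n. 0 \<le> \<phi> x) \<and> cube_expectation n \<phi> = 1"

text \<open>
  Densities are relative to the uniform distribution.  The function \<^const>\<open>embed_pmf\<close> is
  meaningful only on probability mass functions; lemma \<open>pmf_density_pmf\<close> below shows that this is
  the case for every density.
\<close>

definition density_pmf :: "nat \<Rightarrow> ((nat \<Rightarrow> real) \<Rightarrow> real) \<Rightarrow> (nat \<Rightarrow> real) pmf" where
  "density_pmf n \<phi> = embed_pmf (\<lambda>x. if x \<in> hypercube n then \<phi> x / 2 ^ n else 0)"

definition fourier_coeff :: "nat \<Rightarrow> ((nat \<Rightarrow> real) \<Rightarrow> real) \<Rightarrow> nat set \<Rightarrow> real" where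
  "fourier_coeff n \<phi> S = cube_expectation n (\<lambda>x. \<phi> x * (\<Prod>i\<in>S. x i))"

definition kwise_uniform :: "nat \<Rightarrow> nat \<Rightarrow> ((nat \<Rightarrow> real) \<Rightarrow> real) \<Rightarrow> bool" where
  "kwise_uniform n k \<phi> \<longleftrightarrow>
     (\<forall>S\<subseteq>{..<n}. 1 \<le> card S \<and> card S \<le> k \<longrightarrow> fourier_coeff n \<phi> S = 0)"

definition tv_distance ::
  "nat \<Rightarrow> ((nat \<Rightarrow> real) \<Rightarrow> real) \<Rightarrow> ((nat \<Rightarrow> real) \<Rightarrow> real) \<Rightarrow> real" where
  "tv_distance n \<phi> \<psi> = 1 / 2 * cube_expectation n (\<lambda>x. \<bar>\<phi> x - \<psi> x\<bar>)"

definition far_from_kwise_uniform ::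
  "nat \<Rightarrow> nat \<Rightarrow> real \<Rightarrow> ((nat \<Rightarrow> real) \<Rightarrow> real) \<Rightarrow> bool" where
  "far_from_kwise_uniform n k \<delta> \<phi> \<longleftrightarrow>
     (\<forall>\<psi>. cube_density n \<psi> \<and> kwise_uniform n k \<psi> \<longrightarrow> tv_distance n \<phi> \<psi> > \<delta>)"

text \<open>
  A testing algorithm with sample complexity \<open>m\<close> maps a list of \<open>m\<close> samples to a random verdict,
  where \<open>True\<close> stands for ``Yes'' and the randomness of the verdict is that of the internal coins.
\<close>

type_synonym testing_algorithm = "(nat \<Rightarrow> real) list \<Rightarrow> bool pmf"

definition verdict :: "nat \<Rightarrow> nat \<Rightarrow> testing_algorithm \<Rightarrow> ((nat \<Rightarrow> real) \<Rightarrow> real) \<Rightarrow> bool pmf" where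
  "verdict n m A \<phi> = bind_pmf (replicate_pmf m (density_pmf n \<phi>)) A"

definition kwise_uniformity_tester ::
  "nat \<Rightarrow> nat \<Rightarrow> real \<Rightarrow> nat \<Rightarrow> testing_algorithm \<Rightarrow> bool" where
  "kwise_uniformity_tester n k \<delta> m A \<longleftrightarrow>
     (\<forall>\<phi>. cube_density n \<phi> \<longrightarrow>
        (kwise_uniform n k \<phi> \<longrightarrow> pmf (verdict n m A \<phi>) True \<ge> 2 / 3) \<and>
        (far_from_kwise_uniform n k \<delta> \<phi> \<longrightarrow> pmf (verdict n m A \<phi>) False \<ge> 2 / 3))"

lemma finite_hypercube: "finite (hypercube n)"
  unfolding hypercube_def by (intro finite_PiE) auto

lemma card_hypercube: "card (hypercube n) = 2 ^ n"
  unfolding hypercube_def by (simp add: card_PiE numeral_2_eq_2)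

lemma hypercube_nonempty: "hypercube n \<noteq> {}"
  unfolding hypercube_def by (simp add: PiE_eq_empty_iff)

lemma cube_expectation_eq: "cube_expectation n f = (\<Sum>x\<in>hypercube n. f x) / 2 ^ n"
  unfolding cube_expectation_def
  by (simp add: integral_pmf_of_set finite_hypercube hypercube_nonempty card_hypercube)

lemma pmf_density_pmf:
  assumes "cube_density n \<phi>"
  shows "pmf (density_pmf n \<phi>) x = (if x \<in> hypercube n then \<phi> x / 2 ^ n else 0)"
proof -
  let ?f = "\<lambda>x. if x \<in> hypercube n then \<phi> x / 2 ^ n else 0"
  have nonneg: "0 \<le> ?f x" for x
    using assms by (simp add: cube_density_def)
  have "(\<integral>\<^sup>+x. ennreal (?f x) \<partial>count_space UNIV) = (\<Sum>x\<in>hypercube n. ennreal (?f x))"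
    by (rule nn_integral_count_space') (auto simp: finite_hypercube)
  also have "\<dots> = ennreal (\<Sum>x\<in>hypercube n. ?f x)"
    using nonneg by (intro sum_ennreal) blast
  also have "(\<Sum>x\<in>hypercube n. ?f x) = cube_expectation n \<phi>"
    by (simp add: cube_expectation_eq sum_divide_distrib)
  also have "\<dots> = 1"
    using assms by (simp add: cube_density_def)
  finally show ?thesis
    unfolding density_pmf_def using nonneg by (intro pmf_embed_pmf) auto
qed

end

theory Submission
  imports Defs
begin

text \<open>
  Write \<open>W\<close> for the sum of the squared Fourier coefficients of \<open>\<phi>\<close> on the sets of size between
  \<open>1\<close> and \<open>k\<close>. The density \<open>\<phi>\<close> is \<open>\<epsilon>\<close>-close to \<open>k\<close>-wise uniform as soon as some mixture
  \<open>(1 - \<epsilon>) \<phi> + \<epsilon> \<rho>\<close> with a density \<open>\<rho>\<close> has no such coefficients. Choose \<open>\<rho>\<close> minimising their sum of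
  squares and let \<open>v\<close> be the coefficients of the minimiser. If \<open>v \<noteq> 0\<close>, moving \<open>\<rho>\<close> towards the point
  mass at the minimum of the polynomial \<open>q = \<Sum>\<^sub>S v\<^sub>S x\<^sup>S\<close> decreases that sum of squares, provided that
  \<open>\<langle>q, \<phi>\<rangle> \<le> \<epsilon> M\<close> with \<open>M = - min q\<close>. Now \<open>p = q + M\<close> is nonnegative of degree at most \<open>k\<close> and has
  mean \<open>M\<close>, so hypercontractivity gives \<open>\<parallel>q\<parallel>\<^sub>2 \<le> \<parallel>p\<parallel>\<^sub>2 \<le> 3\<^sup>k M\<close>, and \<open>\<epsilon> = 3\<^sup>k \<surd>W\<close> suffices by
  Cauchy--Schwarz. For \<open>k = 1\<close> one has \<open>M = \<Sum>\<^sub>i \<bar>v\<^sub>i\<bar>\<close>, so the largest coefficient is a valid \<open>\<epsilon>\<close>.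
  Hence it is enough to estimate the vector of low coefficients in the Euclidean norm (second
  moment), and for \<open>k = 1\<close> in the maximum norm (Hoeffding and a union bound).
\<close>

section \<open>Hypercontractivity on the hypercube\<close>

lemma cube_expectation_mono:
  assumes "\<And>x. x \<in> hypercube n \<Longrightarrow> f x \<le> g x"
  shows "cube_expectation n f \<le> cube_expectation n g"
  using assms by (auto simp: cube_expectation_eq intro!: divide_right_mono sum_mono)

lemma cube_expectation_nonneg:
  assumes "\<And>x. x \<in> hypercube n \<Longrightarrow> 0 \<le> f x"
  shows "0 \<le> cube_expectation n f"
  using assms by (auto simp: cube_expectation_eq intro!: divide_nonneg_nonneg sum_nonneg)

lemma cube_expectation_cong:
  assumes "\<And>x. x \<in> hypercube n \<Longrightarrow> f x = g x"
  shows "cube_expectation n f = cube_expectation n g"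
  using assms by (auto simp: cube_expectation_eq intro!: sum.cong)

lemma cube_expectation_const [simp]: "cube_expectation n (\<lambda>_. c) = c"
  by (simp add: cube_expectation_eq card_hypercube)

lemma cube_expectation_add:
  "cube_expectation n (\<lambda>x. f x + g x) = cube_expectation n f + cube_expectation n g"
  by (simp add: cube_expectation_eq sum.distrib add_divide_distrib)

lemma cube_expectation_diff:
  "cube_expectation n (\<lambda>x. f x - g x) = cube_expectation n f - cube_expectation n g"
  by (simp add: cube_expectation_eq sum_subtractf diff_divide_distrib)

lemma cube_expectation_mult:
  "cube_expectation n (\<lambda>x. c * f x) = c * cube_expectation n f"
  by (simp add: cube_expectation_eq sum_distrib_left)

lemma cube_expectation_0 [simp]: "cube_expectation 0 f = f (\<lambda>_. undefined)"
  by (simp add: cube_expectation_eq hypercube_def)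

lemma cube_expectation_Cauchy_Schwarz:
  "(cube_expectation n (\<lambda>x. f x * g x))\<^sup>2 \<le>
     cube_expectation n (\<lambda>x. (f x)\<^sup>2) * cube_expectation n (\<lambda>x. (g x)\<^sup>2)"
  unfolding cube_expectation_eq times_divide_times_eq power_divide
  using divide_right_mono[OF Cauchy_Schwarz_ineq_sum[of f g "hypercube n"], of "2 ^ n * 2 ^ n"]
  by (simp add: power2_eq_square)

text \<open>Conditioning on the last coordinate: this is the recursion behind every induction on the
  dimension.\<close>

lemma cube_expectation_Suc:
  "cube_expectation (Suc n) f =
     (cube_expectation n (\<lambda>x. f (x(n := 1))) + cube_expectation n (\<lambda>x. f (x(n := - 1)))) / 2"
proof -
  have "hypercube (Suc n) = (\<lambda>(y, g). g(n := y)) ` ({-1, 1} \<times> hypercube n)"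
    by (simp add: hypercube_def lessThan_Suc PiE_insert_eq)
  moreover have "inj_on (\<lambda>(y, g). g(n := y)) ({-1, 1} \<times> hypercube n)"
    unfolding hypercube_def by (rule inj_combinator) simp
  ultimately have "(\<Sum>x\<in>hypercube (Suc n). f x) =
      (\<Sum>(y, g)\<in>{-1, 1} \<times> hypercube n. f (g(n := y)))"
    by (simp add: sum.reindex case_prod_unfold)
  also have "\<dots> = (\<Sum>y\<in>{-1, 1}. \<Sum>g\<in>hypercube n. f (g(n := y)))"
    by (rule sum.cartesian_product[symmetric])
  also have "\<dots> = (\<Sum>g\<in>hypercube n. f (g(n := -1))) + (\<Sum>g\<in>hypercube n. f (g(n := 1)))"
    by simp
  finally show ?thesis
    by (simp add: cube_expectation_eq add_divide_distrib)
qed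

section \<open>Multilinear polynomials and their moments\<close>

text \<open>A function on the cube is represented by its Fourier coefficients \<open>c\<close>, so
  that both halves of a split along the last coordinate are again of this form, with coefficients
  \<open>c S\<close> and \<open>c (insert n S)\<close>.\<close>

definition multilinear :: "nat \<Rightarrow> (nat set \<Rightarrow> real) \<Rightarrow> (nat \<Rightarrow> real) \<Rightarrow> real" where
  "multilinear n c x = (\<Sum>S\<in>Pow {..<n}. c S * (\<Prod>i\<in>S. x i))"

lemma sum_Pow_Suc:
  fixes f :: "nat set \<Rightarrow> real"
  shows "(\<Sum>S\<in>Pow {..<Suc n}. f S) =
    (\<Sum>S\<in>Pow {..<n}. f S) + (\<Sum>S\<in>Pow {..<n}. f (insert n S))"
proof -
  have "inj_on (insert n) (Pow {..<n})"
    by (rule inj_on_inverseI[where g = "\<lambda>S. S - {n}"]) auto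
  then show ?thesis
    unfolding lessThan_Suc Pow_insert
    by (subst sum.union_disjoint) (auto simp: sum.reindex o_def)
qed

lemma multilinear_Suc:
  "multilinear (Suc n) c (x(n := b)) =
     multilinear n c x + b * multilinear n (\<lambda>S. c (insert n S)) x"
proof -
  have "(\<Prod>i\<in>S. (x(n := b)) i) = (\<Prod>i\<in>S. x i)" if "S \<in> Pow {..<n}" for S
    using that by (intro prod.cong) auto
  moreover have "(\<Prod>i\<in>insert n S. (x(n := b)) i) = b * (\<Prod>i\<in>S. x i)" if "S \<in> Pow {..<n}" for S
  proof -
    have "finite S" "n \<notin> S"
      using that finite_subset[of S "{..<n}"] by auto
    then have "(\<Prod>i\<in>insert n S. (x(n := b)) i) = b * (\<Prod>i\<in>S. (x(n := b)) i)"
      by simp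
    with \<open>n \<notin> S\<close> show ?thesis
      by (auto intro!: prod.cong)
  qed
  ultimately show ?thesis
    unfolding multilinear_def sum_Pow_Suc sum_distrib_left
    by (intro arg_cong2[where f = "(+)"] sum.cong) (simp_all only: ac_simps)
qed

lemma expectation_multilinear: "cube_expectation n (multilinear n c) = c {}"
proof (induction n arbitrary: c)
  case (Suc n)
  then show ?case
    by (simp add: cube_expectation_Suc multilinear_Suc cube_expectation_add cube_expectation_diff)
qed (simp add: multilinear_def)

text \<open>Averaging over the last coordinate turns the square of \<open>g + x_n h\<close> into
  \<open>g^2 + h^2\<close>, by the parallelogram identity.\<close>

lemma Parseval_multilinear:
  "cube_expectation n (\<lambda>x. (multilinear n c x)\<^sup>2) = (\<Sum>S\<in>Pow {..<n}. (c S)\<^sup>2)"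
proof (induction n arbitrary: c)
  case (Suc n)
  let ?g = "multilinear n c" and ?h = "multilinear n (\<lambda>S. c (insert n S))"
  have "cube_expectation (Suc n) (\<lambda>x. (multilinear (Suc n) c x)\<^sup>2) =
      (cube_expectation n (\<lambda>x. (?g x + ?h x)\<^sup>2 + (?g x - ?h x)\<^sup>2)) / 2"
    by (simp add: cube_expectation_Suc multilinear_Suc cube_expectation_add)
  also have "(\<lambda>x. (?g x + ?h x)\<^sup>2 + (?g x - ?h x)\<^sup>2) = (\<lambda>x. 2 * ((?g x)\<^sup>2 + (?h x)\<^sup>2))"
    by (simp add: fun_eq_iff power2_eq_square algebra_simps)
  also have "cube_expectation n \<dots> / 2 = (\<Sum>S\<in>Pow {..<n}. (c S)\<^sup>2) + (\<Sum>S\<in>Pow {..<n}. (c (insert n S))\<^sup>2)"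
    using Suc[of c] Suc[of "\<lambda>S. c (insert n S)"]
    by (simp only: cube_expectation_mult cube_expectation_add) simp
  finally show ?case
    by (simp only: sum_Pow_Suc)
qed (simp add: multilinear_def)

text \<open>The (4,2)-hypercontractive inequality in degree \<open>k\<close>. Split the polynomial
  as \<open>g + x_n h\<close>: terms odd in \<open>x_n\<close> average out, and \<open>h\<close> has
  degree at most \<open>k - 1\<close>. This drop in degree pays for the coefficient 6 of the mixed
  term.\<close>

lemma Bonami:
  assumes "\<And>S. S \<subseteq> {..<n} \<Longrightarrow> k < card S \<Longrightarrow> c S = 0"
  shows "cube_expectation n (\<lambda>x. (multilinear n c x) ^ 4) \<le>
    9 ^ k * (cube_expectation n (\<lambda>x. (multilinear n c x)\<^sup>2))\<^sup>2"
  using assms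
proof (induction n arbitrary: c k)
  case 0
  have "(c {}) ^ 4 * 1 \<le> (c {}) ^ 4 * 9 ^ k"
    by (intro mult_left_mono) auto
  then show ?case
    by (simp add: multilinear_def mult_ac flip: power_mult)
next
  case (Suc n)
  define g where "g = multilinear n c"
  define h where "h = multilinear n (\<lambda>S. c (insert n S))"
  define G where "G = cube_expectation n (\<lambda>x. (g x)\<^sup>2)"
  define H where "H = cube_expectation n (\<lambda>x. (h x)\<^sup>2)"
  have pos: "0 \<le> G" "0 \<le> H"
    unfolding G_def H_def by (auto intro: cube_expectation_nonneg)
  have G: "cube_expectation n (\<lambda>x. (g x) ^ 4) \<le> 9 ^ k * G\<^sup>2"
    unfolding g_def G_def by (intro Suc.IH Suc.prems) (auto simp: lessThan_Suc)
  \<comment> \<open>The extra factor 9 records the lower degree of \<open>h\<close>; for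
    \<open>k = 0\<close> the polynomial \<open>h\<close> vanishes.\<close>
  have H: "9 * cube_expectation n (\<lambda>x. (h x) ^ 4) \<le> 9 ^ k * H\<^sup>2"
  proof (cases k)
    case 0
    have "h x = 0" for x
      unfolding h_def multilinear_def
    proof (intro sum.neutral ballI)
      fix S assume "S \<in> Pow {..<n}"
      then have "c (insert n S) = 0"
        using finite_subset[of S "{..<n}"] 0 by (intro Suc.prems) (auto simp: card_gt_0_iff)
      then show "c (insert n S) * (\<Prod>i\<in>S. x i) = 0"
        by simp
    qed
    then show ?thesis
      by simp
  next
    case (Suc l)
    have "c (insert n S) = 0" if "S \<subseteq> {..<n}" "l < card S" for S
      using that finite_subset[of S "{..<n}"] Suc
      by (intro Suc.prems) (auto simp: card_insert_if)
    then have "cube_expectation n (\<lambda>x. (h x) ^ 4) \<le> 9 ^ l * H\<^sup>2"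
      unfolding h_def H_def by (rule Suc.IH)
    then show ?thesis
      using Suc by simp
  qed
  \<comment> \<open>Cauchy-Schwarz bounds \<open>M\<close> by the geometric mean of the two fourth
    moments. The factor 9 in \<open>H\<close> becomes 3 here, so \<open>6 * M\<close> is at most
    \<open>2 * 9 ^ k * G * H\<close>, exactly the cross term of
    \<open>9 ^ k * (G + H)^2\<close>.\<close>
  define M where "M = cube_expectation n (\<lambda>x. (g x)\<^sup>2 * (h x)\<^sup>2)"
  have "9 * M\<^sup>2 \<le> cube_expectation n (\<lambda>x. (g x) ^ 4) * (9 * cube_expectation n (\<lambda>x. (h x) ^ 4))"
    using cube_expectation_Cauchy_Schwarz[of n "\<lambda>x. (g x)\<^sup>2" "\<lambda>x. (h x)\<^sup>2"]
    by (simp add: M_def flip: power_mult)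
  also have "\<dots> \<le> (9 ^ k * G\<^sup>2) * (9 ^ k * H\<^sup>2)"
    by (rule mult_mono[OF G H]) (auto intro!: cube_expectation_nonneg)
  finally have "(3 * M)\<^sup>2 \<le> (9 ^ k * G * H)\<^sup>2"
    by (simp add: power_mult_distrib power2_eq_square mult_ac)
  then have M: "3 * M \<le> 9 ^ k * G * H"
    by (rule power2_le_imp_le) (use pos in auto)
  have "cube_expectation (Suc n) (\<lambda>x. (multilinear (Suc n) c x) ^ 4) =
      (cube_expectation n (\<lambda>x. (g x + h x) ^ 4 + (g x - h x) ^ 4)) / 2"
    by (simp add: cube_expectation_Suc multilinear_Suc cube_expectation_add g_def h_def)
  also have "(\<lambda>x. (g x + h x) ^ 4 + (g x - h x) ^ 4) =
      (\<lambda>x. 2 * ((g x) ^ 4 + (h x) ^ 4 + 6 * ((g x)\<^sup>2 * (h x)\<^sup>2)))"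
    by (simp add: fun_eq_iff eval_nat_numeral algebra_simps)
  also have "cube_expectation n \<dots> / 2 =
      cube_expectation n (\<lambda>x. (g x) ^ 4) + cube_expectation n (\<lambda>x. (h x) ^ 4) + 6 * M"
    unfolding M_def by (simp only: cube_expectation_mult cube_expectation_add) simp
  also have "\<dots> \<le> 9 ^ k * G\<^sup>2 + 9 ^ k * H\<^sup>2 + 2 * (9 ^ k * G * H)"
    using G H M cube_expectation_nonneg[of n "\<lambda>x. (h x) ^ 4"] by simp
  also have "\<dots> = 9 ^ k * (G + H)\<^sup>2"
    by (simp add: power2_eq_square algebra_simps)
  also have "G + H = cube_expectation (Suc n) (\<lambda>x. (multilinear (Suc n) c x)\<^sup>2)"
    unfolding G_def H_def g_def h_def Parseval_multilinear sum_Pow_Suc ..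
  finally show ?case .
qed

text \<open>Interpolation of moments: with \<open>E j\<close> the \<open>j\<close>-th absolute
  moment, \<open>E 2 ^ 2 \<le> E 1 * E 3\<close> and \<open>E 3 ^ 2 \<le> E 2 * E 4\<close>.
  Inserting the bound on \<open>E 4\<close> and cancelling \<open>E 2 ^ 3\<close> leaves the
  claim.\<close>

lemma L2_le_L1_multilinear:
  assumes "\<And>S. S \<subseteq> {..<n} \<Longrightarrow> k < card S \<Longrightarrow> c S = 0"
  shows "cube_expectation n (\<lambda>x. (multilinear n c x)\<^sup>2) \<le>
    9 ^ k * (cube_expectation n (\<lambda>x. \<bar>multilinear n c x\<bar>))\<^sup>2"
proof -
  define f where "f = multilinear n c"
  define E where "E j = cube_expectation n (\<lambda>x. \<bar>f x\<bar> ^ j)" for j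
  have pos: "0 \<le> E j" for j
    unfolding E_def by (rule cube_expectation_nonneg) simp
  have "(E 2)\<^sup>2 \<le> E 1 * E 3"
  proof -
    \<comment> \<open>Cauchy-Schwarz is applied to the factorisation of
      \<open>\<bar>y\<bar> ^ 2\<close> into the powers 1/2 and 3/2.\<close>
    have "sqrt \<bar>y\<bar> * (sqrt \<bar>y\<bar> * \<bar>y\<bar>) = \<bar>y\<bar> ^ 2" for y :: real
      by (metis abs_idempotent mult.assoc power2_eq_square real_sqrt_mult_self)
    moreover have "(sqrt \<bar>y\<bar> * \<bar>y\<bar>)\<^sup>2 = \<bar>y\<bar> ^ 3" for y :: real
      by (simp add: power_mult_distrib power3_eq_cube power2_eq_square[of y] mult.assoc)
    ultimately show ?thesis
      using cube_expectation_Cauchy_Schwarz[of n "\<lambda>x. sqrt \<bar>f x\<bar>" "\<lambda>x. sqrt \<bar>f x\<bar> * \<bar>f x\<bar>"]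
      by (simp only: E_def) simp
  qed
  then have "((E 2)\<^sup>2)\<^sup>2 \<le> (E 1)\<^sup>2 * (E 3)\<^sup>2"
    using power_mono[of "(E 2)\<^sup>2" "E 1 * E 3" 2] by (simp add: power_mult_distrib)
  also have "(E 3)\<^sup>2 \<le> E 2 * E 4"
    using cube_expectation_Cauchy_Schwarz[of n "\<lambda>x. \<bar>f x\<bar>" "\<lambda>x. \<bar>f x\<bar> ^ 2"]
    by (simp only: E_def flip: power_mult power_Suc) (simp add: eval_nat_numeral)
  also have "E 4 \<le> 9 ^ k * (E 2)\<^sup>2"
    using Bonami[of n k c] assms by (simp add: E_def f_def)
  finally have "((E 2)\<^sup>2)\<^sup>2 \<le> (E 1)\<^sup>2 * (E 2 * (9 ^ k * (E 2)\<^sup>2))"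
    using pos by (simp add: mult_left_mono)
  then have *: "E 2 ^ 3 * E 2 \<le> E 2 ^ 3 * (9 ^ k * (E 1)\<^sup>2)"
    by (simp add: eval_nat_numeral mult_ac)
  have "E 2 \<le> 9 ^ k * (E 1)\<^sup>2"
  proof (cases "E 2 = 0")
    case False
    then show ?thesis
      using * pos[of 2] by (simp add: mult_le_cancel_left zero_less_power_eq)
  qed simp
  then show ?thesis
    by (simp add: E_def f_def)
qed

section \<open>Correcting a density by mixing\<close>

lemma abs_prod_hypercube:
  assumes "x \<in> hypercube n" "S \<subseteq> {..<n}"
  shows "\<bar>\<Prod>i\<in>S. x i\<bar> = 1"
proof -
  have "\<bar>x i\<bar> = 1" if "i \<in> S" for i
    using that assms PiE_mem[of x "{..<n}" "\<lambda>_. {-1, 1}" i] by (fastforce simp: hypercube_def)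
  then show ?thesis
    by (simp add: abs_prod)
qed

text \<open>Tychonoff's theorem, restated for the product topology carried by the function
  type.\<close>

lemma compact_Pi_UNIV:
  assumes "\<And>i. compact (S i)"
  shows "compact {f. \<forall>i. f i \<in> S i}"
proof -
  have "compactin (product_topology (\<lambda>_. euclidean) UNIV) (PiE UNIV S)"
    using assms by (subst compactin_PiE) auto
  then show ?thesis
    by (simp add: euclidean_product_topology PiE_UNIV_domain Pi_def)
qed

lemma cube_density_le:
  assumes "cube_density n \<rho>" "x \<in> hypercube n"
  shows "\<rho> x \<le> 2 ^ n"
proof -
  have "\<rho> x \<le> (\<Sum>y\<in>hypercube n. \<rho> y)"
    using assms finite_hypercube[of n]
    by (intro member_le_sum) (auto simp: cube_density_def)
  also have "\<dots> = 2 ^ n"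
    using assms by (simp add: cube_density_def cube_expectation_eq)
  finally show ?thesis .
qed

text \<open>Fixing the values off the cube to 0 confines every coordinate to a compact set; a
  density alone is unconstrained there.\<close>

lemma compact_cube_densities:
  "compact {\<rho>. cube_density n \<rho> \<and> (\<forall>x. x \<notin> hypercube n \<longrightarrow> \<rho> x = 0)}" (is "compact ?D")
proof -
  let ?B = "{\<rho>. \<forall>x. \<rho> x \<in> (if x \<in> hypercube n then {0..2 ^ n} else {0 :: real})}"
  have "?D = ?B \<inter> {\<rho>. cube_expectation n \<rho> = 1}"
    using cube_density_le[of n] by (auto simp: cube_density_def split: if_splits)
  moreover have "compact ?B"
    by (rule compact_Pi_UNIV) auto
  moreover have "closed {\<rho>. cube_expectation n \<rho> = 1}"
    unfolding cube_expectation_eq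
    by (intro closed_Collect_eq continuous_intros) auto
  ultimately show ?thesis
    by (simp add: compact_Int_closed)
qed

lemma cube_density_convex:
  assumes "cube_density n \<phi>" "cube_density n \<rho>" "0 \<le> t" "t \<le> 1"
  shows "cube_density n (\<lambda>x. (1 - t) * \<phi> x + t * \<rho> x)"
  using assms by (simp add: cube_density_def cube_expectation_add cube_expectation_mult)

lemma fourier_coeff_convex:
  "fourier_coeff n (\<lambda>x. a * \<phi> x + b * \<rho> x) S = a * fourier_coeff n \<phi> S + b * fourier_coeff n \<rho> S"
  unfolding fourier_coeff_def
  by (simp add: distrib_right mult.assoc cube_expectation_add cube_expectation_mult)

definition point_density :: "nat \<Rightarrow> (nat \<Rightarrow> real) \<Rightarrow> (nat \<Rightarrow> real) \<Rightarrow> real" where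
  "point_density n x y = (if y = x then 2 ^ n else 0)"

lemma expectation_point_density:
  assumes "x \<in> hypercube n"
  shows "cube_expectation n (\<lambda>y. point_density n x y * f y) = f x"
proof -
  have "(\<Sum>y\<in>hypercube n. point_density n x y * f y) = (\<Sum>y\<in>hypercube n. if y = x then 2 ^ n * f y else 0)"
    by (intro sum.cong) (auto simp: point_density_def)
  also have "\<dots> = 2 ^ n * f x"
    using assms by (simp add: finite_hypercube)
  finally show ?thesis
    by (simp add: cube_expectation_eq)
qed

lemma cube_density_point_density:
  assumes "x \<in> hypercube n"
  shows "cube_density n (point_density n x)"
  using expectation_point_density[OF assms, of "\<lambda>_. 1"]
  by (simp add: cube_density_def) (simp add: point_density_def)

text \<open>The difference equals \<open>t * (\<phi> - \<rho>)\<close>, and two densities differ by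
  at most 2 in mean absolute value; the factor 1/2 in the distance cancels this.\<close>

lemma tv_distance_le:
  assumes "cube_density n \<phi>" "cube_density n \<rho>" "0 \<le> t"
  shows "tv_distance n \<phi> (\<lambda>x. (1 - t) * \<phi> x + t * \<rho> x) \<le> t"
proof -
  have "cube_expectation n (\<lambda>x. \<bar>\<phi> x - ((1 - t) * \<phi> x + t * \<rho> x)\<bar>) \<le>
      cube_expectation n (\<lambda>x. t * (\<phi> x + \<rho> x))"
  proof (rule cube_expectation_mono)
    fix x assume "x \<in> hypercube n"
    then have "\<bar>\<phi> x - \<rho> x\<bar> \<le> \<phi> x + \<rho> x"
      using assms by (fastforce simp: cube_density_def)
    moreover have "\<phi> x - ((1 - t) * \<phi> x + t * \<rho> x) = t * (\<phi> x - \<rho> x)"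
      by (simp add: algebra_simps)
    ultimately show "\<bar>\<phi> x - ((1 - t) * \<phi> x + t * \<rho> x)\<bar> \<le> t * (\<phi> x + \<rho> x)"
      using assms by (simp add: abs_mult mult_left_mono)
  qed
  also have "\<dots> = 2 * t"
    using assms by (simp add: cube_expectation_mult cube_expectation_add cube_density_def)
  finally show ?thesis
    by (simp add: tv_distance_def)
qed

text \<open>First-order optimality: the assumed expression is the increment of a sum of squares
  along a segment, and \<open>2 * a\<close> is its derivative at 0.\<close>

lemma nonneg_derivative_of_square_min:
  fixes a b :: real
  assumes "\<And>t. 0 < t \<Longrightarrow> t \<le> 1 \<Longrightarrow> 0 \<le> 2 * t * a + t\<^sup>2 * b"
  shows "0 \<le> a"
proof (rule ccontr)
  assume a: "\<not> 0 \<le> a"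
  \<comment> \<open>Chosen so that \<open>t * b \<le> - a\<close>, hence
    \<open>2 * a + t * b \<le> a < 0\<close>. The added 1 keeps the denominator positive when
    \<open>b = 0\<close>.\<close>
  define t where "t = min 1 (- a / (\<bar>b\<bar> + 1))"
  have t: "0 < t" "t \<le> 1"
    using a by (auto simp: t_def divide_less_0_iff)
  have "t * b \<le> t * (\<bar>b\<bar> + 1)"
    using t by (intro mult_left_mono) auto
  also have "\<dots> \<le> - a"
    by (simp add: t_def min_def pos_le_divide_eq[symmetric] add_nonneg_pos)
  finally have "t * (2 * a + t * b) < 0"
    using a t by (simp add: mult_less_0_iff)
  with assms[OF t] show False
    by (simp add: power2_eq_square algebra_simps)
qed

text \<open>The hypothesis \<open>witness\<close> is a dual condition on directions
  \<open>v\<close>, each certified by a single point of the cube. It is applied to the residual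
  coefficient vector of the best mixture. The family \<open>F\<close> stays abstract to cover both
  the general case and \<open>k = 1\<close>.\<close>

lemma closeness_criterion:
  fixes F :: "nat set set"
  assumes \<phi>: "cube_density n \<phi>" and F: "finite F" and \<epsilon>: "0 \<le> \<epsilon>" "\<epsilon> \<le> 1"
  assumes witness: "\<And>v. \<exists>x\<in>hypercube n. (\<Sum>S\<in>F. v S * (\<Prod>i\<in>S. x i)) \<le> 0 \<and>
    (\<Sum>S\<in>F. v S * fourier_coeff n \<phi> S) \<le> - \<epsilon> * (\<Sum>S\<in>F. v S * (\<Prod>i\<in>S. x i))"
  obtains \<psi> where "cube_density n \<psi>" "\<And>S. S \<in> F \<Longrightarrow> fourier_coeff n \<psi> S = 0"
    "tv_distance n \<phi> \<psi> \<le> \<epsilon>"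
proof -
  define mix where "mix \<rho> = (\<lambda>x. (1 - \<epsilon>) * \<phi> x + \<epsilon> * \<rho> x)" for \<rho>
  define c where "c \<rho> S = fourier_coeff n (mix \<rho>) S" for \<rho> S
  define D where "D = {\<rho>. cube_density n \<rho> \<and> (\<forall>x. x \<notin> hypercube n \<longrightarrow> \<rho> x = 0)}"
  have c_eq: "c \<rho> S = (1 - \<epsilon>) * fourier_coeff n \<phi> S + \<epsilon> * fourier_coeff n \<rho> S" for \<rho> S
    by (simp add: c_def mix_def fourier_coeff_convex)
  have point: "point_density n x \<in> D" if "x \<in> hypercube n" for x
    using that by (auto simp: D_def cube_density_point_density point_density_def)
  have "continuous_on D (\<lambda>\<rho>. \<Sum>S\<in>F. (c \<rho> S)\<^sup>2)"
    unfolding c_eq fourier_coeff_def cube_expectation_eq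
    by (intro continuous_intros continuous_on_subset[OF continuous_on_product_coordinates]) auto
  moreover have "D \<noteq> {}"
    using point hypercube_nonempty[of n] by blast
  ultimately obtain \<rho> where \<rho>: "\<rho> \<in> D" "\<And>\<rho>'. \<rho>' \<in> D \<Longrightarrow> (\<Sum>S\<in>F. (c \<rho> S)\<^sup>2) \<le> (\<Sum>S\<in>F. (c \<rho>' S)\<^sup>2)"
    using continuous_attains_inf[of D "\<lambda>\<rho>. \<Sum>S\<in>F. (c \<rho> S)\<^sup>2"] compact_cube_densities[of n]
    unfolding D_def by blast
  define v where "v = c \<rho>"
  obtain x where x: "x \<in> hypercube n" "(\<Sum>S\<in>F. v S * (\<Prod>i\<in>S. x i)) \<le> 0"
    "(\<Sum>S\<in>F. v S * fourier_coeff n \<phi> S) \<le> - \<epsilon> * (\<Sum>S\<in>F. v S * (\<Prod>i\<in>S. x i))"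
    using witness by blast
  define w where "w = c (point_density n x)"
  have w: "w S = (1 - \<epsilon>) * fourier_coeff n \<phi> S + \<epsilon> * (\<Prod>i\<in>S. x i)" for S
    unfolding w_def c_eq using x(1)
    by (simp add: fourier_coeff_def expectation_point_density)
  \<comment> \<open>Moving \<open>\<rho>\<close> towards the point mass at \<open>x\<close> stays in
    the convex set \<open>D\<close> and, \<open>c\<close> being affine, moves the coefficients along
    the segment from \<open>v\<close> to \<open>w\<close>. Minimality of \<open>\<rho>\<close>
    forbids a decrease at its start.\<close>
  have "0 \<le> (\<Sum>S\<in>F. v S * (w S - v S))"
  proof (rule nonneg_derivative_of_square_min)
    fix t :: real assume t: "0 < t" "t \<le> 1"
    define \<rho>' where "\<rho>' = (\<lambda>y. (1 - t) * \<rho> y + t * point_density n x y)"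
    have "\<rho>' \<in> D"
      using t \<rho>(1) point[OF x(1)] by (auto simp: D_def \<rho>'_def intro: cube_density_convex)
    then have "(\<Sum>S\<in>F. (v S)\<^sup>2) \<le> (\<Sum>S\<in>F. (c \<rho>' S)\<^sup>2)"
      unfolding v_def by (rule \<rho>(2))
    also have "c \<rho>' S = v S + t * (w S - v S)" for S
      unfolding v_def w_def c_eq \<rho>'_def fourier_coeff_convex by (simp add: algebra_simps)
    then have "(\<Sum>S\<in>F. (c \<rho>' S)\<^sup>2) = (\<Sum>S\<in>F. (v S)\<^sup>2 + 2 * t * (v S * (w S - v S)) + t\<^sup>2 * (w S - v S)\<^sup>2)"
      unfolding \<open>\<And>S. c \<rho>' S = v S + t * (w S - v S)\<close>
      by (intro sum.cong) (auto simp: power2_eq_square algebra_simps)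
    also have "\<dots> = (\<Sum>S\<in>F. (v S)\<^sup>2) + 2 * t * (\<Sum>S\<in>F. v S * (w S - v S)) + t\<^sup>2 * (\<Sum>S\<in>F. (w S - v S)\<^sup>2)"
      by (simp add: sum.distrib sum_distrib_left)
    finally show "0 \<le> 2 * t * (\<Sum>S\<in>F. v S * (w S - v S)) + t\<^sup>2 * (\<Sum>S\<in>F. (w S - v S)\<^sup>2)"
      by simp
  qed
  \<comment> \<open>Optimality bounds the squared norm of \<open>v\<close> by its inner product with
    \<open>w\<close>; the witness bounds that product by \<open>\<epsilon>^2\<close> times the
    nonpositive value of the polynomial at \<open>x\<close>. So \<open>v\<close> vanishes.\<close>
  then have "(\<Sum>S\<in>F. (v S)\<^sup>2) \<le> (\<Sum>S\<in>F. v S * w S)"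
    by (simp add: right_diff_distrib sum_subtractf power2_eq_square)
  also have "\<dots> = (1 - \<epsilon>) * (\<Sum>S\<in>F. v S * fourier_coeff n \<phi> S) + \<epsilon> * (\<Sum>S\<in>F. v S * (\<Prod>i\<in>S. x i))"
    unfolding w sum_distrib_left sum.distrib[symmetric]
    by (intro sum.cong) (auto simp: algebra_simps)
  also have "\<dots> \<le> (1 - \<epsilon>) * (- \<epsilon> * (\<Sum>S\<in>F. v S * (\<Prod>i\<in>S. x i))) + \<epsilon> * (\<Sum>S\<in>F. v S * (\<Prod>i\<in>S. x i))"
    using x(3) \<epsilon> by (intro add_mono mult_left_mono) auto
  also have "\<dots> = \<epsilon>\<^sup>2 * (\<Sum>S\<in>F. v S * (\<Prod>i\<in>S. x i))"
    by (simp add: power2_eq_square algebra_simps)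
  also have "\<dots> \<le> 0"
    using x(2) by (simp add: mult_nonneg_nonpos)
  finally have "(\<Sum>S\<in>F. (v S)\<^sup>2) = 0"
    by (simp add: antisym sum_nonneg)
  then have "fourier_coeff n (mix \<rho>) S = 0" if "S \<in> F" for S
    using that F by (simp add: sum_nonneg_eq_0_iff v_def c_def)
  moreover have "cube_density n (mix \<rho>)" "tv_distance n \<phi> (mix \<rho>) \<le> \<epsilon>"
    using \<rho>(1) \<phi> \<epsilon> unfolding mix_def D_def
    by (auto intro!: cube_density_convex tv_distance_le)
  ultimately show thesis
    using that by blast
qed

section \<open>Deviations of empirical means\<close>

lemma finite_set_replicate_pmf:
  assumes "finite (set_pmf p)"
  shows "finite (set_pmf (replicate_pmf m p))"
  unfolding set_replicate_pmf
  by (rule finite_subset[OF _ finite_lists_length_eq[OF assms, of m]]) auto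

text \<open>Conditioning on the first sample. Finite support makes every real function
  integrable.\<close>

lemma expectation_replicate_pmf_Suc:
  fixes h :: "'a list \<Rightarrow> real"
  assumes p: "finite (set_pmf p)"
  shows "measure_pmf.expectation (replicate_pmf (Suc m) p) h =
    measure_pmf.expectation p (\<lambda>x. measure_pmf.expectation (replicate_pmf m p) (\<lambda>xs. h (x # xs)))"
proof -
  have "replicate_pmf (Suc m) p = bind_pmf p (\<lambda>x. map_pmf ((#) x) (replicate_pmf m p))"
    by (simp add: map_pmf_def)
  then have "measure_pmf.expectation (replicate_pmf (Suc m) p) h =
      (\<Sum>x\<in>set_pmf p. pmf p x * measure_pmf.expectation (replicate_pmf m p) (\<lambda>xs. h (x # xs)))"
    using p by (simp add: pmf_expectation_bind[of "set_pmf p"] finite_set_replicate_pmf)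
  also have "\<dots> = measure_pmf.expectation p (\<lambda>x. measure_pmf.expectation (replicate_pmf m p) (\<lambda>xs. h (x # xs)))"
    using p by (subst integral_measure_pmf_real[of "set_pmf p"]) (auto simp: mult_ac)
  finally show ?thesis .
qed

lemma expectation_sum_list_replicate_pmf:
  fixes f :: "'a \<Rightarrow> real"
  assumes p: "finite (set_pmf p)" and f: "measure_pmf.expectation p f = 0"
  shows "measure_pmf.expectation (replicate_pmf m p) (\<lambda>xs. sum_list (map f xs)) = 0"
proof (induction m)
  case (Suc m)
  then show ?case
    using p f
    by (simp add: expectation_replicate_pmf_Suc integrable_measure_pmf_finite finite_set_replicate_pmf
          del: replicate_pmf.simps)
qed simp

text \<open>Additivity of variance: the cross term between the first sample and the rest vanishes
  because \<open>f\<close> is centred.\<close>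

lemma expectation_sum_list_squared_replicate_pmf:
  fixes f :: "'a \<Rightarrow> real"
  assumes p: "finite (set_pmf p)" and f: "measure_pmf.expectation p f = 0"
  shows "measure_pmf.expectation (replicate_pmf m p) (\<lambda>xs. (sum_list (map f xs))\<^sup>2) =
    real m * measure_pmf.expectation p (\<lambda>x. (f x)\<^sup>2)"
proof (induction m)
  case (Suc m)
  have "measure_pmf.expectation (replicate_pmf m p) (\<lambda>xs. (f x + sum_list (map f xs))\<^sup>2) =
      (f x)\<^sup>2 + real m * measure_pmf.expectation p (\<lambda>x. (f x)\<^sup>2)" for x
    using Suc expectation_sum_list_replicate_pmf[OF p f, of m] p
    by (simp add: power2_sum integrable_measure_pmf_finite finite_set_replicate_pmf)
  then show ?case
    using p
    by (simp add: expectation_replicate_pmf_Suc integrable_measure_pmf_finite distrib_right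
          del: replicate_pmf.simps)
qed simp

lemma expectation_exp_sum_list_replicate_pmf:
  fixes f :: "'a \<Rightarrow> real"
  assumes p: "finite (set_pmf p)"
  shows "measure_pmf.expectation (replicate_pmf m p) (\<lambda>xs. exp (sum_list (map f xs))) =
    measure_pmf.expectation p (\<lambda>x. exp (f x)) ^ m"
proof (induction m)
  case (Suc m)
  then show ?case
    using p by (simp add: expectation_replicate_pmf_Suc exp_add del: replicate_pmf.simps)
qed simp

text \<open>Markov's inequality as domination of an indicator, in a form that serves both the
  second-moment and the exponential bound.\<close>

lemma Markov_finite_pmf:
  fixes g :: "'a \<Rightarrow> real"
  assumes M: "finite (set_pmf M)"
    and g: "\<And>x. x \<in> set_pmf M \<Longrightarrow> 0 \<le> g x" "\<And>x. x \<in> set_pmf M \<Longrightarrow> x \<in> A \<Longrightarrow> 1 \<le> g x"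
  shows "measure_pmf.prob M A \<le> measure_pmf.expectation M g"
proof -
  have "measure_pmf.prob M A = measure_pmf.expectation M (indicator A)"
    by simp
  also have "\<dots> \<le> measure_pmf.expectation M g"
    using M g
    by (intro integral_mono_AE integrable_measure_pmf_finite) (auto simp: AE_measure_pmf_iff indicator_def)
  finally show ?thesis .
qed

definition empirical_mean :: "('a \<Rightarrow> real) \<Rightarrow> 'a list \<Rightarrow> real" where
  "empirical_mean f xs = sum_list (map f xs) / real (length xs)"

lemma sum_list_centered:
  fixes f :: "'a \<Rightarrow> real"
  assumes "xs \<noteq> []"
  shows "sum_list (map (\<lambda>x. f x - c) xs) = real (length xs) * (empirical_mean f xs - c)"
proof -
  have "sum_list (map (\<lambda>x. f x - c) ys) = sum_list (map f ys) - real (length ys) * c" for ys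
    by (induction ys) (auto simp: algebra_simps)
  with assms show ?thesis
    by (simp add: empirical_mean_def algebra_simps)
qed

lemma centered_bounded_pmf:
  fixes f :: "'a \<Rightarrow> real"
  assumes "finite (set_pmf p)" and "\<And>x. x \<in> set_pmf p \<Longrightarrow> \<bar>f x\<bar> \<le> 1"
  defines "\<mu> \<equiv> measure_pmf.expectation p f"
  shows "measure_pmf.expectation p (\<lambda>x. f x - \<mu>) = 0"
    and "measure_pmf.expectation p (\<lambda>x. (f x - \<mu>)\<^sup>2) \<le> 1"
proof -
  note int = integrable_measure_pmf_finite[OF assms(1)]
  show "measure_pmf.expectation p (\<lambda>x. f x - \<mu>) = 0"
    by (simp add: int \<mu>_def)
  have "measure_pmf.expectation p (\<lambda>x. (f x)\<^sup>2) \<le> measure_pmf.expectation p (\<lambda>x. 1)"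
    using assms(2)
    by (intro integral_mono_AE int) (auto simp: AE_measure_pmf_iff abs_square_le_1)
  then have "measure_pmf.expectation p (\<lambda>x. (f x)\<^sup>2) \<le> 1"
    by simp
  moreover have "measure_pmf.expectation p (\<lambda>x. (f x - \<mu>)\<^sup>2) =
      measure_pmf.expectation p (\<lambda>x. (f x)\<^sup>2) - \<mu>\<^sup>2"
    by (simp add: power2_diff int \<mu>_def) (simp add: power2_eq_square)
  ultimately show "measure_pmf.expectation p (\<lambda>x. (f x - \<mu>)\<^sup>2) \<le> 1"
    using zero_le_power2[of \<mu>] by linarith
qed

text \<open>Chebyshev's inequality in Euclidean norm: each empirical mean has variance at most
  \<open>1 / m\<close>, the expectations add up over \<open>F\<close>, and Markov's inequality is
  applied once to the total.\<close>

lemma prob_empirical_family_deviation: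
  fixes f :: "'s \<Rightarrow> 'a \<Rightarrow> real"
  assumes p: "finite (set_pmf p)" and F: "finite F" and m: "0 < m" and t: "0 < t"
    and f: "\<And>S x. S \<in> F \<Longrightarrow> x \<in> set_pmf p \<Longrightarrow> \<bar>f S x\<bar> \<le> 1"
  shows "measure_pmf.prob (replicate_pmf m p)
      {xs. t \<le> (\<Sum>S\<in>F. (empirical_mean (f S) xs - measure_pmf.expectation p (f S))\<^sup>2)}
    \<le> real (card F) / (real m * t)" (is "measure_pmf.prob ?M ?A \<le> _")
proof -
  define d where "d S x = f S x - measure_pmf.expectation p (f S)" for S x
  define g where "g xs = (\<Sum>S\<in>F. (sum_list (map (d S) xs))\<^sup>2) / (t * (real m)\<^sup>2)" for xs
  have M: "finite (set_pmf ?M)"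
    by (rule finite_set_replicate_pmf[OF p])
  have "measure_pmf.prob ?M ?A \<le> measure_pmf.expectation ?M g"
  proof (rule Markov_finite_pmf[OF M])
    fix xs assume xs: "xs \<in> set_pmf ?M"
    show "0 \<le> g xs"
      using t by (simp add: g_def sum_nonneg)
    have len: "length xs = m" "xs \<noteq> []"
      using xs m by (auto simp: set_replicate_pmf)
    assume "xs \<in> ?A"
    then have "t * (real m)\<^sup>2 \<le> (\<Sum>S\<in>F. (sum_list (map (d S) xs))\<^sup>2)"
      unfolding d_def sum_list_centered[OF len(2)] len power_mult_distrib sum_distrib_left[symmetric]
      by (subst mult.commute) (auto intro: mult_left_mono)
    then show "1 \<le> g xs"
      using t m by (simp add: g_def)
  qed
  also have "\<dots> = (\<Sum>S\<in>F. real m * measure_pmf.expectation p (\<lambda>x. (d S x)\<^sup>2)) / (t * (real m)\<^sup>2)"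
  proof -
    have "measure_pmf.expectation ?M (\<lambda>xs. (sum_list (map (d S) xs))\<^sup>2) =
        real m * measure_pmf.expectation p (\<lambda>x. (d S x)\<^sup>2)" if "S \<in> F" for S
      using centered_bounded_pmf(1)[OF p, of "f S"] f that
      by (intro expectation_sum_list_squared_replicate_pmf[OF p]) (simp add: d_def[abs_def])
    then show ?thesis
      unfolding g_def by (simp add: integrable_measure_pmf_finite[OF M])
  qed
  also have "\<dots> \<le> (\<Sum>S\<in>F. real m * 1) / (t * (real m)\<^sup>2)"
    using centered_bounded_pmf(2)[OF p, of "f _"] f t
    by (intro divide_right_mono sum_mono mult_left_mono) (auto simp: d_def)
  also have "\<dots> = real (card F) / (real m * t)"
    using m t by (simp add: power2_eq_square field_simps)
  finally show ?thesis .
qed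

text \<open>Chernoff's method with Hoeffding's lemma. The exponent
  \<open>- m * s * \<epsilon> + m * s^2 / 2\<close> is smallest at \<open>s = \<epsilon>\<close>,
  which explains why \<open>\<epsilon>\<close> is also the parameter of the exponential.\<close>

lemma prob_empirical_mean_upper:
  fixes f :: "'a \<Rightarrow> real"
  assumes p: "finite (set_pmf p)" and m: "0 < m" and \<epsilon>: "0 < \<epsilon>"
    and f: "\<And>x. x \<in> set_pmf p \<Longrightarrow> \<bar>f x\<bar> \<le> 1"
  shows "measure_pmf.prob (replicate_pmf m p)
      {xs. \<epsilon> \<le> empirical_mean f xs - measure_pmf.expectation p f} \<le> exp (- (real m * \<epsilon>\<^sup>2 / 2))"
    (is "measure_pmf.prob ?M ?A \<le> _")
proof -
  define d where "d x = f x - measure_pmf.expectation p f" for x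
  define g where "g xs = exp (- (real m * \<epsilon>\<^sup>2)) * exp (sum_list (map (\<lambda>x. \<epsilon> * d x) xs))" for xs
  have M: "finite (set_pmf ?M)"
    by (rule finite_set_replicate_pmf[OF p])
  have "measure_pmf.prob ?M ?A \<le> measure_pmf.expectation ?M g"
  proof (rule Markov_finite_pmf[OF M])
    fix xs assume xs: "xs \<in> set_pmf ?M"
    show "0 \<le> g xs"
      by (simp add: g_def)
    have len: "length xs = m" "xs \<noteq> []"
      using xs m by (auto simp: set_replicate_pmf)
    assume "xs \<in> ?A"
    then have "real m * \<epsilon> \<le> sum_list (map d xs)"
      unfolding d_def sum_list_centered[OF len(2)] len by (intro mult_left_mono) auto
    then have "\<epsilon> * (real m * \<epsilon>) \<le> \<epsilon> * sum_list (map d xs)"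
      using \<epsilon> by (intro mult_left_mono) auto
    then show "1 \<le> g xs"
      by (simp add: g_def sum_list_const_mult power2_eq_square mult_ac flip: exp_add)
  qed
  also have "\<dots> = exp (- (real m * \<epsilon>\<^sup>2)) * measure_pmf.expectation p (\<lambda>x. exp (\<epsilon> * d x)) ^ m"
    unfolding g_def by (simp add: expectation_exp_sum_list_replicate_pmf[OF p])
  also have "measure_pmf.expectation p (\<lambda>x. exp (\<epsilon> * d x)) \<le> exp (\<epsilon>\<^sup>2 / 2)"
  proof -
    \<comment> \<open>The range has length 2, so the exponent \<open>\<epsilon>^2 * 2^2 / 8\<close>
      of Hoeffding's lemma is \<open>\<epsilon>^2 / 2\<close>.\<close>
    interpret interval_bounded_random_variable "measure_pmf p" f "-1" 1
      using f by unfold_locales (auto simp: AE_measure_pmf_iff abs_le_iff)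
    have "ennreal (measure_pmf.expectation p (\<lambda>x. exp (\<epsilon> * d x))) =
        (\<integral>\<^sup>+x. ennreal (exp (\<epsilon> * d x)) \<partial>measure_pmf p)"
      by (rule nn_integral_eq_integral[symmetric]) (auto intro: integrable_measure_pmf_finite[OF p])
    also have "\<dots> \<le> ennreal (exp (\<epsilon>\<^sup>2 / 2))"
      using Hoeffdings_lemma_nn_integral[OF \<epsilon>] by (simp add: d_def)
    finally show ?thesis
      by simp
  qed
  then have "exp (- (real m * \<epsilon>\<^sup>2)) * measure_pmf.expectation p (\<lambda>x. exp (\<epsilon> * d x)) ^ m \<le>
      exp (- (real m * \<epsilon>\<^sup>2)) * exp (\<epsilon>\<^sup>2 / 2) ^ m"
    by (intro mult_left_mono power_mono) auto
  also have "\<dots> = exp (- (real m * \<epsilon>\<^sup>2 / 2))"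
    by (simp add: field_simps flip: exp_of_nat_mult exp_add)
  finally show ?thesis .
qed

lemma prob_empirical_mean_deviation:
  fixes f :: "'a \<Rightarrow> real"
  assumes p: "finite (set_pmf p)" and m: "0 < m" and \<epsilon>: "0 < \<epsilon>"
    and f: "\<And>x. x \<in> set_pmf p \<Longrightarrow> \<bar>f x\<bar> \<le> 1"
  shows "measure_pmf.prob (replicate_pmf m p)
      {xs. \<epsilon> \<le> \<bar>empirical_mean f xs - measure_pmf.expectation p f\<bar>} \<le> 2 * exp (- (real m * \<epsilon>\<^sup>2 / 2))"
    (is "measure_pmf.prob ?M ?A \<le> _")
proof -
  let ?B = "\<lambda>f. {xs. \<epsilon> \<le> empirical_mean f xs - measure_pmf.expectation p f}"
  have "empirical_mean (\<lambda>x. - f x) xs = - empirical_mean f xs" for xs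
    unfolding empirical_mean_def minus_divide_left uminus_sum_list_map o_def ..
  then have "?A \<subseteq> ?B f \<union> ?B (\<lambda>x. - f x)"
    by (auto simp: abs_if split: if_splits)
  then have "measure_pmf.prob ?M ?A \<le> measure_pmf.prob ?M (?B f \<union> ?B (\<lambda>x. - f x))"
    by (intro measure_pmf.finite_measure_mono) auto
  also have "\<dots> \<le> measure_pmf.prob ?M (?B f) + measure_pmf.prob ?M (?B (\<lambda>x. - f x))"
    by (intro measure_Un_le) auto
  also have "\<dots> \<le> exp (- (real m * \<epsilon>\<^sup>2 / 2)) + exp (- (real m * \<epsilon>\<^sup>2 / 2))"
    using f by (intro add_mono prob_empirical_mean_upper p m \<epsilon>) auto
  finally show ?thesis
    by simp
qed

section \<open>Closeness to \<open>k\<close>-wise uniformity\<close>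

lemma expectation_density_pmf:
  assumes "cube_density n \<phi>"
  shows "measure_pmf.expectation (density_pmf n \<phi>) f = cube_expectation n (\<lambda>x. \<phi> x * f x)"
proof -
  have "measure_pmf.expectation (density_pmf n \<phi>) f =
      (\<Sum>x\<in>hypercube n. f x * pmf (density_pmf n \<phi>) x)"
    using assms
    by (intro integral_measure_pmf_real finite_hypercube)
       (auto simp: set_pmf_iff pmf_density_pmf split: if_splits)
  then show ?thesis
    using assms by (simp add: pmf_density_pmf cube_expectation_eq sum_divide_distrib mult_ac)
qed

lemma set_density_pmf:
  assumes "cube_density n \<phi>"
  shows "set_pmf (density_pmf n \<phi>) \<subseteq> hypercube n"
  using assms by (auto simp: set_pmf_iff pmf_density_pmf split: if_splits)

text \<open>Here \<open>A\<close> is a bad event of large estimation error. The same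
  \<open>A\<close> serves both verdicts of a tester.\<close>

lemma pmf_verdict_deterministic_ge:
  assumes "measure_pmf.prob (replicate_pmf m (density_pmf n \<phi>)) A \<le> 1 / 3"
    and "\<And>xs. xs \<notin> A \<Longrightarrow> T xs = b"
  shows "2 / 3 \<le> pmf (verdict n m (\<lambda>xs. return_pmf (T xs)) \<phi>) b"
proof -
  let ?M = "replicate_pmf m (density_pmf n \<phi>)"
  have "verdict n m (\<lambda>xs. return_pmf (T xs)) \<phi> = map_pmf T ?M"
    by (simp add: verdict_def map_pmf_def)
  then have "pmf (verdict n m (\<lambda>xs. return_pmf (T xs)) \<phi>) b = measure_pmf.prob ?M (T -` {b})"
    by (simp add: pmf_map)
  moreover have "measure_pmf.prob ?M (- A) \<le> measure_pmf.prob ?M (T -` {b})"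
    using assms(2) by (intro measure_pmf.finite_measure_mono) auto
  moreover have "measure_pmf.prob ?M (- A) = 1 - measure_pmf.prob ?M A"
    using measure_pmf.prob_compl[of A ?M] by (simp add: Compl_eq_Diff_UNIV)
  ultimately show ?thesis
    using assms(1) by linarith
qed

text \<open>A character is the polynomial with a single coefficient, at \<open>S\<close>; its mean
  is the coefficient at the empty set, which differs from \<open>S\<close>.\<close>

lemma uniform_kwise_uniform: "kwise_uniform n k (\<lambda>_. 1)"
  unfolding kwise_uniform_def
proof (intro allI impI)
  fix S :: "nat set" assume S: "S \<subseteq> {..<n}" "1 \<le> card S \<and> card S \<le> k"
  have "multilinear n (\<lambda>T. if T = S then 1 else 0) = (\<lambda>x. \<Prod>i\<in>S. x i)"
    using S(1) by (simp add: fun_eq_iff multilinear_def if_distrib[of "\<lambda>c. c * _"] sum.delta cong: if_cong)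
  then have "fourier_coeff n (\<lambda>_. 1) S = cube_expectation n (multilinear n (\<lambda>T. if T = S then 1 else 0))"
    by (simp add: fourier_coeff_def)
  also have "\<dots> = 0"
    using S(2) by (auto simp: expectation_multilinear)
  finally show "fourier_coeff n (\<lambda>_. 1) S = 0" .
qed

lemma far_from_kwise_uniform_less_1:
  assumes "cube_density n \<phi>" "far_from_kwise_uniform n k \<delta> \<phi>"
  shows "\<delta> < 1"
proof -
  have "cube_density n (\<lambda>_. 1)"
    by (simp add: cube_density_def)
  then have "tv_distance n \<phi> (\<lambda>_. 1) \<le> 1" "\<delta> < tv_distance n \<phi> (\<lambda>_. 1)"
    using assms tv_distance_le[of n \<phi> "\<lambda>_. 1" 1] uniform_kwise_uniform
    by (auto simp: far_from_kwise_uniform_def)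
  then show ?thesis
    by simp
qed

text \<open>For \<open>\<delta> \<ge> 1\<close> no density is far. This case must cost no samples,
  since the claimed bounds fall below 1 as \<open>\<delta>\<close> grows.\<close>

lemma trivial_tester:
  assumes "1 \<le> \<delta>"
  shows "kwise_uniformity_tester n k \<delta> 0 (\<lambda>_. return_pmf True)"
  unfolding kwise_uniformity_tester_def
  using assms far_from_kwise_uniform_less_1[of n _ k \<delta>]
    pmf_verdict_deterministic_ge[of 0 n _ "{}" "\<lambda>_. True"]
  by fastforce

definition low_sets :: "nat \<Rightarrow> nat \<Rightarrow> nat set set" where
  "low_sets n k = {S. S \<subseteq> {..<n} \<and> 1 \<le> card S \<and> card S \<le> k}"

lemma finite_low_sets [simp]: "finite (low_sets n k)"
  by (rule finite_subset[of _ "Pow {..<n}"]) (auto simp: low_sets_def)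

lemma kwise_uniform_iff_low_sets:
  "kwise_uniform n k \<phi> \<longleftrightarrow> (\<forall>S\<in>low_sets n k. fourier_coeff n \<phi> S = 0)"
  by (auto simp: kwise_uniform_def low_sets_def)

text \<open>Each binomial is at most \<open>n ^ j / j!\<close>. Since \<open>n / k \<ge> 1\<close>,
  the factor \<open>(n / k) ^ k\<close> can be pulled out, leaving a partial sum of the series of
  \<open>exp k\<close>, which is at most \<open>3 ^ k\<close>.\<close>

lemma card_low_sets_le:
  assumes "1 \<le> k" "k \<le> n"
  shows "real (card (low_sets n k)) \<le> 3 ^ k * (real n / real k) ^ k"
proof -
  have "low_sets n k = (\<Union>j\<in>{1..k}. {S. S \<subseteq> {..<n} \<and> card S = j})"
    by (auto simp: low_sets_def)
  then have "card (low_sets n k) \<le> (\<Sum>j\<in>{1..k}. card {S. S \<subseteq> {..<n} \<and> card S = j})"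
    using card_UN_le[of "{1..k}" "\<lambda>j. {S. S \<subseteq> {..<n} \<and> card S = j}"] by simp
  also have "\<dots> = (\<Sum>j\<in>{1..k}. n choose j)"
    using n_subsets[of "{..<n}"] by simp
  finally have "real (card (low_sets n k)) \<le> (\<Sum>j\<in>{1..k}. real (n choose j))"
    by (metis of_nat_le_iff of_nat_sum)
  also have "\<dots> \<le> (\<Sum>j\<in>{1..k}. (real n / real k) ^ k * (real k ^ j /\<^sub>R fact j))"
  proof (rule sum_mono)
    fix j assume j: "j \<in> {1..k}"
    have "real (n choose j) * fact j \<le> real n ^ j"
      using binomial_fact_pow[of n j] by (metis of_nat_fact of_nat_le_iff of_nat_mult of_nat_power)
    then have "real (n choose j) \<le> real n ^ j / fact j"
      by (simp add: field_simps)
    also have "\<dots> = (real n / real k) ^ j * (real k ^ j / fact j)"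
      using assms by (simp add: power_divide)
    also have "\<dots> \<le> (real n / real k) ^ k * (real k ^ j / fact j)"
      using assms j by (intro mult_right_mono power_increasing) auto
    finally show "real (n choose j) \<le> (real n / real k) ^ k * (real k ^ j /\<^sub>R fact j)"
      by (simp add: field_simps)
  qed
  also have "\<dots> = (real n / real k) ^ k * (\<Sum>j\<in>{1..k}. real k ^ j /\<^sub>R fact j)"
    by (simp add: sum_distrib_left)
  also have "\<dots> \<le> (real n / real k) ^ k * exp (real k)"
    unfolding exp_def by (intro mult_left_mono sum_le_suminf summable_exp_generic) auto
  also have "exp (real k) \<le> 3 ^ k"
    using power_mono[OF exp_le, of k] by (simp flip: exp_of_nat_mult)
  then have "(real n / real k) ^ k * exp (real k) \<le> 3 ^ k * (real n / real k) ^ k"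
    by (subst mult.commute) (intro mult_right_mono, auto)
  finally show ?thesis .
qed

lemma nine_power: "(9 :: real) ^ k = (3 ^ k)\<^sup>2"
  by (simp add: power2_eq_square flip: power_mult_distrib)

lemma close_to_kwise_uniform:
  assumes \<phi>: "cube_density n \<phi>"
    and \<epsilon>_def: "\<epsilon> = 3 ^ k * sqrt (\<Sum>S\<in>low_sets n k. (fourier_coeff n \<phi> S)\<^sup>2)"
    and \<epsilon>: "\<epsilon> \<le> 1"
  obtains \<psi> where "cube_density n \<psi>" "kwise_uniform n k \<psi>" "tv_distance n \<phi> \<psi> \<le> \<epsilon>"
proof (rule closeness_criterion[OF \<phi>, of "low_sets n k" \<epsilon>])
  define W where "W = (\<Sum>S\<in>low_sets n k. (fourier_coeff n \<phi> S)\<^sup>2)"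
  have W: "0 \<le> W" "\<epsilon> = 3 ^ k * sqrt W"
    by (auto simp: W_def \<epsilon>_def sum_nonneg)
  show "0 \<le> \<epsilon>" using W by simp
  fix v :: "nat set \<Rightarrow> real"
  define c where "c S = (if S \<in> low_sets n k then v S else 0)" for S
  define q where "q x = (\<Sum>S\<in>low_sets n k. v S * (\<Prod>i\<in>S. x i))" for x :: "nat \<Rightarrow> real"
  obtain x where x: "x \<in> hypercube n" "\<And>y. y \<in> hypercube n \<Longrightarrow> q x \<le> q y"
    using finite_hypercube[of n] hypercube_nonempty[of n] arg_min_if_finite[of "hypercube n" q]
    by (metis not_le_imp_less)
  \<comment> \<open>The constant is stored at the empty set, which is not a low set. On the cube
    \<open>p\<close> is \<open>q\<close> minus its minimum, so it is nonnegative and its L1 norm is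
    its mean \<open>- q x\<close>.\<close>
  define p where "p = multilinear n (c({} := - q x))"
  have low: "low_sets n k \<subseteq> Pow {..<n} - {{}}"
    by (auto simp: low_sets_def)
  have split_Pow: "(\<Sum>S\<in>Pow {..<n}. h S) = h {} + (\<Sum>S\<in>low_sets n k. h S)"
    if "\<And>S. S \<in> Pow {..<n} - {{}} - low_sets n k \<Longrightarrow> h S = 0" for h :: "nat set \<Rightarrow> real"
    using that low sum.mono_neutral_right[of "Pow {..<n} - {{}}" "low_sets n k" h]
    by (subst sum.remove[of _ "{}"]) auto
  have "p y = - q x + q y" for y
    unfolding p_def multilinear_def q_def[of y]
    by (subst split_Pow) (use low in \<open>auto simp: c_def intro!: sum.cong\<close>)
  then have "\<bar>p y\<bar> = p y" if "y \<in> hypercube n" for y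
    using x(2)[OF that] by simp
  then have abs_p: "cube_expectation n (\<lambda>y. \<bar>p y\<bar>) = - q x"
    using cube_expectation_cong[of n "\<lambda>y. \<bar>p y\<bar>" p] by (simp add: p_def expectation_multilinear)
  then have neg: "q x \<le> 0"
    using cube_expectation_nonneg[of n "\<lambda>y. \<bar>p y\<bar>"] by simp
  \<comment> \<open>Discarding the constant coefficient only shrinks the sum of squares, which by
    Parseval is the second moment of \<open>p\<close>.\<close>
  have "(\<Sum>S\<in>low_sets n k. (v S)\<^sup>2) \<le> (\<Sum>S\<in>Pow {..<n}. ((c({} := - q x)) S)\<^sup>2)"
    by (subst split_Pow) (use low in \<open>auto simp: c_def intro!: sum_mono add_increasing\<close>)
  also have "\<dots> \<le> 9 ^ k * (q x)\<^sup>2"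
  proof -
    have "(c({} := - q x)) S = 0" if "S \<subseteq> {..<n}" "k < card S" for S
      using that by (auto simp: c_def low_sets_def)
    then have "cube_expectation n (\<lambda>y. (p y)\<^sup>2) \<le> 9 ^ k * (cube_expectation n (\<lambda>y. \<bar>p y\<bar>))\<^sup>2"
      unfolding p_def by (rule L2_le_L1_multilinear)
    then show ?thesis
      unfolding abs_p unfolding p_def Parseval_multilinear by simp
  qed
  finally have v: "(\<Sum>S\<in>low_sets n k. (v S)\<^sup>2) \<le> 9 ^ k * (q x)\<^sup>2" .
  have "(\<Sum>S\<in>low_sets n k. v S * fourier_coeff n \<phi> S)\<^sup>2 \<le> (\<Sum>S\<in>low_sets n k. (v S)\<^sup>2) * W"
    unfolding W_def by (rule Cauchy_Schwarz_ineq_sum)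
  also have "\<dots> \<le> 9 ^ k * (q x)\<^sup>2 * W"
    using v W by (intro mult_right_mono) auto
  also have "\<dots> = (- \<epsilon> * q x)\<^sup>2"
    using W by (simp add: power_mult_distrib nine_power)
  finally have "(\<Sum>S\<in>low_sets n k. v S * fourier_coeff n \<phi> S) \<le> - \<epsilon> * q x"
    by (rule power2_le_imp_le) (use neg W in \<open>simp add: mult_nonneg_nonpos\<close>)
  then show "\<exists>x\<in>hypercube n. (\<Sum>S\<in>low_sets n k. v S * (\<Prod>i\<in>S. x i)) \<le> 0 \<and>
      (\<Sum>S\<in>low_sets n k. v S * fourier_coeff n \<phi> S) \<le>
        - \<epsilon> * (\<Sum>S\<in>low_sets n k. v S * (\<Prod>i\<in>S. x i))"
    using x(1) neg unfolding q_def by blast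
qed (use that \<epsilon> in \<open>auto simp: kwise_uniform_iff_low_sets\<close>)

text \<open>A linear form has minimum minus the l1 norm of its coefficients, and the dual of that
  norm is the maximum norm. This avoids a loss depending on \<open>n\<close>.\<close>

lemma close_to_1wise_uniform:
  assumes \<phi>: "cube_density n \<phi>" and \<epsilon>: "0 \<le> \<epsilon>" "\<epsilon> \<le> 1"
    and coeff: "\<And>i. i < n \<Longrightarrow> \<bar>fourier_coeff n \<phi> {i}\<bar> \<le> \<epsilon>"
  obtains \<psi> where "cube_density n \<psi>" "kwise_uniform n 1 \<psi>" "tv_distance n \<phi> \<psi> \<le> \<epsilon>"
proof (rule closeness_criterion[OF \<phi>, of "(\<lambda>i. {i}) ` {..<n}" \<epsilon>])
  fix v :: "nat set \<Rightarrow> real"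
  \<comment> \<open>The sign vector opposite to \<open>v\<close>, at which the linear form attains
    its minimum.\<close>
  define x where "x = (\<lambda>i\<in>{..<n}. if 0 < v {i} then - 1 else 1 :: real)"
  have x: "x \<in> hypercube n"
    by (auto simp: x_def hypercube_def)
  have "(\<Sum>i<n. v {i} * x i) = (\<Sum>i<n. - \<bar>v {i}\<bar>)"
    by (intro sum.cong) (auto simp: x_def)
  then have min: "(\<Sum>i<n. v {i} * x i) = - (\<Sum>i<n. \<bar>v {i}\<bar>)"
    by (simp add: sum_negf)
  have "(\<Sum>i<n. v {i} * fourier_coeff n \<phi> {i}) \<le> (\<Sum>i<n. \<epsilon> * \<bar>v {i}\<bar>)"
  proof (rule sum_mono)
    fix i assume "i \<in> {..<n}"
    then have "\<bar>v {i}\<bar> * \<bar>fourier_coeff n \<phi> {i}\<bar> \<le> \<bar>v {i}\<bar> * \<epsilon>"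
      by (intro mult_left_mono coeff) auto
    then show "v {i} * fourier_coeff n \<phi> {i} \<le> \<epsilon> * \<bar>v {i}\<bar>"
      by (simp add: mult.commute abs_mult[symmetric])
  qed
  then show "\<exists>x\<in>hypercube n. (\<Sum>S\<in>(\<lambda>i. {i}) ` {..<n}. v S * (\<Prod>i\<in>S. x i)) \<le> 0 \<and>
      (\<Sum>S\<in>(\<lambda>i. {i}) ` {..<n}. v S * fourier_coeff n \<phi> S) \<le>
        - \<epsilon> * (\<Sum>S\<in>(\<lambda>i. {i}) ` {..<n}. v S * (\<Prod>i\<in>S. x i))"
    using x min by (intro bexI[of _ x]) (auto simp: sum.reindex sum_distrib_left sum_negf sum_nonneg)
next
  fix \<psi> assume \<psi>: "cube_density n \<psi>" "tv_distance n \<phi> \<psi> \<le> \<epsilon>"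
    and zero: "\<And>S. S \<in> (\<lambda>i. {i}) ` {..<n} \<Longrightarrow> fourier_coeff n \<psi> S = 0"
  have "kwise_uniform n 1 \<psi>"
    unfolding kwise_uniform_def
  proof (intro allI impI)
    fix S :: "nat set" assume "S \<subseteq> {..<n}" "1 \<le> card S \<and> card S \<le> 1"
    then obtain i where "S = {i}" "i < n"
      by (metis card_1_singletonE insert_subset le_antisym lessThan_iff)
    then show "fourier_coeff n \<psi> S = 0"
      by (intro zero) auto
  qed
  with \<psi> that show thesis
    by blast
qed (use \<epsilon> in auto)

section \<open>Testers\<close>

definition squares_test :: "nat \<Rightarrow> nat \<Rightarrow> real \<Rightarrow> testing_algorithm" where
  "squares_test n k t xs = return_pmf
     ((\<Sum>S\<in>low_sets n k. (empirical_mean (\<lambda>x. \<Prod>i\<in>S. x i) xs)\<^sup>2) < t)"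

text \<open>Let \<open>t\<close> be the threshold. The sample bound keeps the squared estimation
  error below \<open>t\<close> with probability at least 2/3. For a uniform \<open>\<phi>\<close>
  this error is the statistic itself; for a far one the true squared norm is at least
  \<open>4 * t\<close>, so the statistic exceeds \<open>t\<close>.\<close>

lemma squares_tester:
  assumes \<delta>: "0 < \<delta>" "\<delta> < 1" and m: "0 < m"
    and samples: "12 * real (card (low_sets n k)) * 9 ^ k \<le> real m * \<delta>\<^sup>2"
  shows "kwise_uniformity_tester n k \<delta> m (squares_test n k (\<delta>\<^sup>2 / (4 * 9 ^ k)))"
  unfolding kwise_uniformity_tester_def
proof (intro allI impI)
  fix \<phi> assume \<phi>: "cube_density n \<phi>"
  let ?t = "\<delta>\<^sup>2 / (4 * 9 ^ k)" and ?F = "low_sets n k"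
  let ?e = "\<lambda>S. empirical_mean (\<lambda>x. \<Prod>i\<in>S. x i)" and ?c = "fourier_coeff n \<phi>"
  define A where "A = {xs. ?t \<le> (\<Sum>S\<in>?F. (?e S xs - ?c S)\<^sup>2)}"
  have mean: "measure_pmf.expectation (density_pmf n \<phi>) (\<lambda>x. \<Prod>i\<in>S. x i) = ?c S" for S
    by (simp add: expectation_density_pmf[OF \<phi>] fourier_coeff_def)
  have "measure_pmf.prob (replicate_pmf m (density_pmf n \<phi>)) A \<le> real (card ?F) / (real m * ?t)"
    unfolding A_def mean[symmetric]
    using \<delta> set_density_pmf[OF \<phi>] abs_prod_hypercube[of _ n]
    by (intro prob_empirical_family_deviation m finite_low_sets
          finite_subset[OF set_density_pmf[OF \<phi>] finite_hypercube])
       (auto simp: low_sets_def subset_iff)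
  also have "\<dots> \<le> 1 / 3"
  proof -
    have "0 < real m * ?t"
      using m \<delta> by simp
    moreover have "3 * real (card ?F) \<le> real m * ?t"
      using samples by (simp add: pos_le_divide_eq)
    ultimately show ?thesis
      by (simp only: pos_divide_le_eq)
  qed
  finally have A: "measure_pmf.prob (replicate_pmf m (density_pmf n \<phi>)) A \<le> 1 / 3" .
  have "2 / 3 \<le> pmf (verdict n m (squares_test n k ?t) \<phi>) True" if "kwise_uniform n k \<phi>"
    unfolding squares_test_def[abs_def] using that
    by (intro pmf_verdict_deterministic_ge[OF A]) (auto simp: A_def kwise_uniform_iff_low_sets)
  moreover have "2 / 3 \<le> pmf (verdict n m (squares_test n k ?t) \<phi>) False"
    if far: "far_from_kwise_uniform n k \<delta> \<phi>"
  proof -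
    \<comment> \<open>Contrapositive of the mixing bound; \<open>\<delta> < 1\<close> ensures an
      admissible mixing weight.\<close>
    have W: "\<delta>\<^sup>2 / 9 ^ k \<le> (\<Sum>S\<in>?F. (?c S)\<^sup>2)"
    proof (rule ccontr)
      assume "\<not> ?thesis"
      then have "(3 ^ k * sqrt (\<Sum>S\<in>?F. (?c S)\<^sup>2))\<^sup>2 \<le> \<delta>\<^sup>2"
        by (simp add: power_mult_distrib sum_nonneg not_le pos_less_divide_eq mult.commute
              flip: nine_power)
      then have "3 ^ k * sqrt (\<Sum>S\<in>?F. (?c S)\<^sup>2) \<le> \<delta>"
        by (rule power2_le_imp_le) (use \<delta> in simp)
      moreover from this have "3 ^ k * sqrt (\<Sum>S\<in>?F. (?c S)\<^sup>2) \<le> 1"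
        using \<delta> by linarith
      from close_to_kwise_uniform[OF \<phi> refl this] obtain \<psi> where
        "cube_density n \<psi>" "kwise_uniform n k \<psi>"
        "tv_distance n \<phi> \<psi> \<le> 3 ^ k * sqrt (\<Sum>S\<in>?F. (?c S)\<^sup>2)" .
      ultimately have "\<not> far_from_kwise_uniform n k \<delta> \<phi>"
        unfolding far_from_kwise_uniform_def by (meson not_less order_trans)
      with far show False
        by simp
    qed
    show ?thesis
      unfolding squares_test_def[abs_def]
    proof (rule pmf_verdict_deterministic_ge[OF A])
      fix xs assume "xs \<notin> A"
      then have dev: "(\<Sum>S\<in>?F. (?e S xs - ?c S)\<^sup>2) < ?t"
        by (simp add: A_def)
      have "(\<Sum>S\<in>?F. (?c S)\<^sup>2) \<le> (\<Sum>S\<in>?F. 2 * (?e S xs)\<^sup>2 + 2 * (?e S xs - ?c S)\<^sup>2)"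
      proof (rule sum_mono)
        fix S
        \<comment> \<open>This square is exactly the difference of the two sides below.\<close>
        have "0 \<le> (2 * ?e S xs - ?c S)\<^sup>2"
          by simp
        then show "(?c S)\<^sup>2 \<le> 2 * (?e S xs)\<^sup>2 + 2 * (?e S xs - ?c S)\<^sup>2"
          by (simp add: power2_eq_square algebra_simps)
      qed
      also have "\<dots> = 2 * (\<Sum>S\<in>?F. (?e S xs)\<^sup>2) + 2 * (\<Sum>S\<in>?F. (?e S xs - ?c S)\<^sup>2)"
        by (simp add: sum.distrib sum_distrib_left)
      finally have "\<delta>\<^sup>2 / 9 ^ k \<le> 2 * (\<Sum>S\<in>?F. (?e S xs)\<^sup>2) + 2 * (\<Sum>S\<in>?F. (?e S xs - ?c S)\<^sup>2)"
        using W by linarith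
      moreover have "\<delta>\<^sup>2 / 9 ^ k = 4 * ?t"
        by simp
      ultimately have "\<not> (\<Sum>S\<in>?F. (?e S xs)\<^sup>2) < ?t"
        using dev by linarith
      then show "((\<Sum>S\<in>?F. (?e S xs)\<^sup>2) < ?t) = False"
        by simp
    qed
  qed
  ultimately show "(kwise_uniform n k \<phi> \<longrightarrow> 2 / 3 \<le> pmf (verdict n m (squares_test n k ?t) \<phi>) True) \<and>
      (far_from_kwise_uniform n k \<delta> \<phi> \<longrightarrow> 2 / 3 \<le> pmf (verdict n m (squares_test n k ?t) \<phi>) False)"
    by blast
qed

section \<open>The coordinatewise test for \<open>k = 1\<close>\<close>

definition coordinates_test :: "nat \<Rightarrow> real \<Rightarrow> testing_algorithm" where
  "coordinates_test n t xs = return_pmf (\<forall>i<n. \<bar>empirical_mean (\<lambda>x. x i) xs\<bar> < t)"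

text \<open>A union bound over the coordinates makes all errors smaller than
  \<open>\<delta> / 2\<close> at once. A far density has some coefficient above
  \<open>\<delta>\<close>, whose estimate then stays above \<open>\<delta> / 2\<close>.\<close>

lemma coordinates_tester:
  assumes \<delta>: "0 < \<delta>" "\<delta> < 1" and m: "0 < m"
    and samples: "2 * real n * exp (- (real m * \<delta>\<^sup>2 / 8)) \<le> 1 / 3"
  shows "kwise_uniformity_tester n 1 \<delta> m (coordinates_test n (\<delta> / 2))"
  unfolding kwise_uniformity_tester_def
proof (intro allI impI)
  fix \<phi> assume \<phi>: "cube_density n \<phi>"
  let ?M = "replicate_pmf m (density_pmf n \<phi>)"
  let ?e = "\<lambda>i. empirical_mean (\<lambda>x. x i)" and ?c = "\<lambda>i. fourier_coeff n \<phi> {i}"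
  define B where "B i = {xs. \<delta> / 2 \<le> \<bar>?e i xs - ?c i\<bar>}" for i
  define A where "A = (\<Union>i<n. B i)"
  have mean: "measure_pmf.expectation (density_pmf n \<phi>) (\<lambda>x. x i) = ?c i" for i
    by (simp add: expectation_density_pmf[OF \<phi>] fourier_coeff_def)
  have "measure_pmf.prob ?M A \<le> (\<Sum>i<n. measure_pmf.prob ?M (B i))"
    unfolding A_def by (intro measure_UNION_le) auto
  also have "\<dots> \<le> (\<Sum>i<n. 2 * exp (- (real m * (\<delta> / 2)\<^sup>2 / 2)))"
  proof (rule sum_mono)
    fix i assume "i \<in> {..<n}"
    then show "measure_pmf.prob ?M (B i) \<le> 2 * exp (- (real m * (\<delta> / 2)\<^sup>2 / 2))"
      unfolding B_def mean[symmetric]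
      using \<delta> set_density_pmf[OF \<phi>] abs_prod_hypercube[of _ n "{i}"]
      by (intro prob_empirical_mean_deviation m finite_subset[OF set_density_pmf[OF \<phi>] finite_hypercube])
         (auto simp: subset_iff)
  qed
  also have "\<dots> = 2 * real n * exp (- (real m * \<delta>\<^sup>2 / 8))"
    by (simp add: power_divide)
  finally have A: "measure_pmf.prob ?M A \<le> 1 / 3"
    using samples by simp
  have "2 / 3 \<le> pmf (verdict n m (coordinates_test n (\<delta> / 2)) \<phi>) True" if "kwise_uniform n 1 \<phi>"
  proof -
    have "?c i = 0" if "i < n" for i
      using \<open>kwise_uniform n 1 \<phi>\<close> that by (auto simp: kwise_uniform_def)
    then show ?thesis
      unfolding coordinates_test_def[abs_def]
      by (intro pmf_verdict_deterministic_ge[OF A]) (auto simp: A_def B_def not_le)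
  qed
  moreover have "2 / 3 \<le> pmf (verdict n m (coordinates_test n (\<delta> / 2)) \<phi>) False"
    if far: "far_from_kwise_uniform n 1 \<delta> \<phi>"
  proof -
    obtain i where i: "i < n" "\<delta> < \<bar>?c i\<bar>"
    proof (rule ccontr)
      assume "\<not> thesis"
      with that have "\<bar>?c i\<bar> \<le> \<delta>" if "i < n" for i
        using \<open>i < n\<close> by force
      then obtain \<psi> where "cube_density n \<psi>" "kwise_uniform n 1 \<psi>" "tv_distance n \<phi> \<psi> \<le> \<delta>"
        using close_to_1wise_uniform[OF \<phi>, of \<delta>] \<delta> by force
      with far show False
        by (auto simp: far_from_kwise_uniform_def not_less[symmetric])
    qed
    show ?thesis
      unfolding coordinates_test_def[abs_def]
    proof (rule pmf_verdict_deterministic_ge[OF A])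
      fix xs assume "xs \<notin> A"
      then have "\<bar>?e i xs - ?c i\<bar> < \<delta> / 2"
        using i(1) by (auto simp: A_def B_def not_le)
      then have "\<not> \<bar>?e i xs\<bar> < \<delta> / 2"
        using i(2) by linarith
      then show "(\<forall>i<n. \<bar>?e i xs\<bar> < \<delta> / 2) = False"
        using i(1) by blast
    qed
  qed
  ultimately show "(kwise_uniform n 1 \<phi> \<longrightarrow> 2 / 3 \<le> pmf (verdict n m (coordinates_test n (\<delta> / 2)) \<phi>) True) \<and>
      (far_from_kwise_uniform n 1 \<delta> \<phi> \<longrightarrow> 2 / 3 \<le> pmf (verdict n m (coordinates_test n (\<delta> / 2)) \<phi>) False)"
    by blast
qed

section \<open>Explicit sample sizes\<close>

text \<open>The constant is \<open>351 = 13 * 27\<close>, with 13 absorbed into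
  \<open>13 ^ k\<close>. Writing a \<open>k\<close>-th power as a square to the power
  \<open>k / 2\<close> gives \<open>351^2 / k^2\<close>, and \<open>k \<le> k^2\<close> gives the
  stated base.\<close>

lemma kwise_sample_bound:
  assumes "1 \<le> k"
  shows "13 * (27 ^ k * (real n / real k) ^ k) \<le> (351\<^sup>2 / real k) powr (real k / 2) * real n ^ k"
proof -
  have "13 * 27 ^ k \<le> (13 ^ k * 27 ^ k :: real)"
    using assms power_increasing[of 1 k "13 :: real"] by (intro mult_right_mono) auto
  then have "13 * 27 ^ k / real k ^ k \<le> (351 / real k) ^ k"
    by (simp add: power_divide divide_right_mono flip: power_mult_distrib)
  also have "\<dots> = ((351 / real k)\<^sup>2) powr (real k / 2)"
    using assms by (simp add: powr_powr flip: powr_realpow powr_numeral)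
  also have "\<dots> \<le> (351\<^sup>2 / real k) powr (real k / 2)"
    using assms by (intro powr_mono2) (auto simp: power_divide power2_eq_square divide_simps)
  finally have "13 * 27 ^ k / real k ^ k * real n ^ k \<le> (351\<^sup>2 / real k) powr (real k / 2) * real n ^ k"
    by (intro mult_right_mono) auto
  then show ?thesis
    by (simp add: power_divide)
qed

lemma exists_kwise_tester:
  assumes k: "1 \<le> k" "k \<le> n" and \<delta>: "0 < \<delta>"
  shows "\<exists>m A. kwise_uniformity_tester n k \<delta> m A \<and>
    real m \<le> (351\<^sup>2 / real k) powr (real k / 2) * (real n ^ k / \<delta>\<^sup>2)"
proof (cases "1 \<le> \<delta>")
  case True
  then show ?thesis
    using trivial_tester[of \<delta> n k] by (intro exI[of _ 0]) auto
next
  case False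
  then have "\<delta>\<^sup>2 \<le> 1"
    using \<delta> by (intro power_le_one) auto
  define L where "L = real (card (low_sets n k)) * 9 ^ k"
  have "{0} \<in> low_sets n k"
    using k by (auto simp: low_sets_def)
  then have "1 \<le> card (low_sets n k)"
    by (metis One_nat_def Suc_leI card_gt_0_iff empty_iff finite_low_sets)
  then have L: "1 \<le> L"
    using mult_mono[of 1 "real (card (low_sets n k))" 1 "9 ^ k"] by (simp add: L_def)
  \<comment> \<open>The 12 is the one in \<open>squares_tester\<close>; rounding up adds at most
    \<open>1 \<le> L / \<delta>^2\<close>, whence 13.\<close>
  define m where "m = nat \<lceil>12 * L / \<delta>\<^sup>2\<rceil>"
  have m_ge: "12 * L / \<delta>\<^sup>2 \<le> real m"
    unfolding m_def by linarith
  have "0 < 12 * L / \<delta>\<^sup>2"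
    using L \<delta> by simp
  then have "0 < m"
    using m_ge by simp
  have "1 \<le> L / \<delta>\<^sup>2"
    using L \<delta> \<open>\<delta>\<^sup>2 \<le> 1\<close> by simp
  then have "real m \<le> 13 * L / \<delta>\<^sup>2"
    unfolding m_def by linarith
  also have "L \<le> 3 ^ k * (real n / real k) ^ k * 9 ^ k"
    unfolding L_def using card_low_sets_le[OF k] by (intro mult_right_mono) auto
  then have "13 * L / \<delta>\<^sup>2 \<le> 13 * (3 ^ k * (real n / real k) ^ k * 9 ^ k) / \<delta>\<^sup>2"
    by (intro divide_right_mono) auto
  also have "3 ^ k * (real n / real k) ^ k * 9 ^ k = 27 ^ k * (real n / real k) ^ k"
    by (simp flip: power_mult_distrib)
  also have "13 * (27 ^ k * (real n / real k) ^ k) / \<delta>\<^sup>2 \<le>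
      (351\<^sup>2 / real k) powr (real k / 2) * real n ^ k / \<delta>\<^sup>2"
    using kwise_sample_bound[OF k(1)] by (intro divide_right_mono) auto
  finally have "real m \<le> (351\<^sup>2 / real k) powr (real k / 2) * (real n ^ k / \<delta>\<^sup>2)"
    by simp
  moreover have "12 * real (card (low_sets n k)) * 9 ^ k \<le> real m * \<delta>\<^sup>2"
    using m_ge \<delta> by (simp add: L_def divide_le_eq)
  ultimately show ?thesis
    using squares_tester[of \<delta> m n k] False \<delta> \<open>0 < m\<close> by auto
qed

text \<open>The condition \<open>2 \<le> n\<close> keeps the logarithm positive; at
  \<open>n = 1\<close> the bound would allow no samples at all.\<close>

lemma exists_1wise_tester:
  assumes n: "2 \<le> n" and \<delta>: "0 < \<delta>"
  shows "\<exists>m A. kwise_uniformity_tester n 1 \<delta> m A \<and> real m \<le> 34 * (ln (real n) / \<delta>\<^sup>2)"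
proof (cases "1 \<le> \<delta>")
  case True
  then show ?thesis
    using n trivial_tester[of \<delta> n 1] by (intro exI[of _ 0]) auto
next
  case False
  then have "\<delta>\<^sup>2 \<le> 1"
    using \<delta> by (intro power_le_one) auto
  define L where "L = ln (real n)"
  \<comment> \<open>From \<open>ln (1 + x) \<le> x\<close> at \<open>x = - 1 / 2\<close>.\<close>
  have "1 / 2 \<le> ln (2 :: real)"
    using ln_add_one_self_le_self2[of "- 1 / 2 :: real"] by (simp add: ln_div)
  also have "\<dots> \<le> L"
    using n by (simp add: L_def)
  finally have L: "1 / 2 \<le> L" .
  \<comment> \<open>With 32 the failure probability is at most
    \<open>2 * n * exp (- 4 * ln n) = 2 / n ^ 3 \<le> 1 / 4\<close>. Rounding up costs at most
    \<open>1 \<le> 2 * L / \<delta>^2\<close>, whence 34.\<close>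
  define m where "m = nat \<lceil>32 * L / \<delta>\<^sup>2\<rceil>"
  have m_ge: "32 * L / \<delta>\<^sup>2 \<le> real m"
    unfolding m_def by linarith
  have "0 < 32 * L / \<delta>\<^sup>2"
    using L \<delta> by simp
  then have "0 < m"
    using m_ge by simp
  have "1 \<le> 2 * L / \<delta>\<^sup>2"
    using L \<delta> \<open>\<delta>\<^sup>2 \<le> 1\<close> by simp
  then have m_le: "real m \<le> 34 * (L / \<delta>\<^sup>2)"
    unfolding m_def by linarith
  have "4 * L \<le> real m * \<delta>\<^sup>2 / 8"
    using m_ge \<delta> by (simp add: field_simps)
  then have "exp (- (real m * \<delta>\<^sup>2 / 8)) \<le> exp (- (4 * L))"
    by simp
  also have "\<dots> = 1 / real n ^ 4"
    using n by (simp add: L_def exp_minus exp_of_nat_mult[of 4, simplified] inverse_eq_divide)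
  finally have "2 * real n * exp (- (real m * \<delta>\<^sup>2 / 8)) \<le> 2 * real n * (1 / real n ^ 4)"
    by (intro mult_left_mono) auto
  also have "\<dots> = 2 / real n ^ 3"
    using n by (simp add: eval_nat_numeral)
  also have "\<dots> \<le> 2 / 2 ^ 3"
    using n by (intro divide_left_mono power_mono) auto
  finally have "2 * real n * exp (- (real m * \<delta>\<^sup>2 / 8)) \<le> 1 / 3"
    by simp
  with m_le show ?thesis
    using coordinates_tester[of \<delta> m n] False \<delta> \<open>0 < m\<close> by (auto simp: L_def)
qed

theorem theorem3:
  shows "(\<exists>C::real. C > 0 \<and>
            (\<forall>(n::nat) (k::nat) (\<delta>::real). 1 \<le> k \<and> k \<le> n \<and> 0 < \<delta> \<longrightarrow>
               (\<exists>m A. kwise_uniformity_tester n k \<delta> m A \<and>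
                  real m \<le> (C / real k) powr (real k / 2) * (real n ^ k / \<delta>\<^sup>2)))) \<and>
         (\<exists>C::real. C > 0 \<and>
            (\<forall>(n::nat) (\<delta>::real). 2 \<le> n \<and> 0 < \<delta> \<longrightarrow>
               (\<exists>m A. kwise_uniformity_tester n 1 \<delta> m A \<and>
                  real m \<le> C * (ln (real n) / \<delta>\<^sup>2))))"
  by (intro conjI exI[of _ "351\<^sup>2"] exI[of _ 34] allI impI exists_kwise_tester exists_1wise_tester)
    auto

end
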